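(* Let $\mathcal{B}$ be a saturated set, $\mathcal{M}$ a $\mathcal{B}$-model, and $\mathcal{I}$ an $\mathcal{M}$-interpretation. Let $\Gamma=\{x_i:A_i\}_{1\le i\le n}$ and $\Theta=\{\alpha_j:B_j\}_{1\le j\le m}$. Let $M_i\in\mathcal{I}(A_i)$ for all $1\le i\le n$, and for all $1\le j\le m$ let $\bar P_j\sqsubseteq\bar N_j$ with $\bar N_j\in(\mathcal{I}(B_j))^{\mathcal{B}}$. Let $\sigma=[(x_i:=M_i)_{1\le i\le n};(\alpha_j:=_r\bar P_j)_{1\le j\le m}]$. If $\Gamma\vdash M:A;\Theta$ and $M\sigma\in\mathcal{T}_t$, then $M\sigma\in\mathcal{I}(A)$.
   Context: $\lambda\mu$-terms are generated by $\mathcal{T} ::= x \mid \lambda x.\mathcal{T} \mid (\mathcal{T})\mathcal{T} \mid [\alpha]\mathcal{T} \mid \mu\alpha.\mathcal{T}$ ($x$ $\lambda$-variables, $\alpha$ $\mu$-variables), up to renaming of bound variables, substitutions avoiding capture. Types: $A ::= X \mid \bot \mid A\to B$, $X$ atomic. Typing judgments $\Gamma\vdash M:A;\Theta$ ($\Gamma$ finite set of $x:A$, $\Theta$ finite set of $\alpha:B$, each variable at most once) are derived by: $\Gamma,x:A\vdash x:A;\Theta$; from $\Gamma,x:A\vdash M:B;\Theta$ infer $\Gamma\vdash\lambda x.M:A\to B;\Theta$; from $\Gamma\vdash M:A\to B;\Theta$ and $\Gamma\vdash N:A;\Theta$ infer $\Gamma\vdash(M)N:B;\Theta$; from $\Gamma\vdash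 M:A;\alpha:A,\Theta$ infer $\Gamma\vdash[\alpha]M:\bot;\alpha:A,\Theta$; from $\Gamma\vdash M:\bot;\alpha:A,\Theta$ infer $\Gamma\vdash\mu\alpha.M:A;\Theta$. $\mathcal{T}_t$ = set of typable terms. For a finite sequence $\bar P=P_1\dots P_k$, $(M)\bar P=(\dots((M)P_1)\dots)P_k$, $(M)\varnothing=M$; $\bar P\sqsubseteq\bar N$ means $\bar P$ is an initial segment (possibly empty or all) of $\bar N$; $\mathcal{L}^{<\omega}$ is the set of finite sequences from $\mathcal{L}$. $M[x:=N]$ is usual substitution; $M[\alpha:=_rN]$ replaces inductively every subterm $[\alpha]P$ by $[\alpha](P')N$ ($P'$ = $P$ with the substitution applied), and $M[\alpha:=_r N_1\dots N_n]=M[\alpha:=_rN_1]\dots[\alpha:=_rN_n]$. Saturated set: $\mathcal{B}\subseteq\mathcal{T}_t$ with (C1) $M\in\mathcal{B}\Rightarrow\lambda x.M\in\mathcal{B}$; (C2) $M\in\mathcal{B}$, $\mu\alpha.M\in\mathcal{T}_t\Rightarrow\mu\alpha.M\in\mathcal{B}$; (C3) $M\in\mathcal{B}$, $[\alpha]M\in\mathcal{T}_t\Rightarrow[\alpha]M\in\mathcal{B}$; (C4) $n\ge0$, $N_1,\dots,N_n\in\mathcal{B}$, $(x)N_1\dots N_n\in\mathcal{T}_t\Rightarrow(x)N_1\dots N_n\in\mathcal{B}$; (C5) $M,N\in\mathcal{T}_t$, $\bar P\in\mathcal{T}_t^{<\omega}$, $N\in\mathcal{B}$, $(\lambda x.M)N\bar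 P\in\mathcal{T}_t$, $(M[x:=N])\bar P\in\mathcal{B}\Rightarrow(\lambda x.M)N\bar P\in\mathcal{B}$; (C6) $M\in\mathcal{T}_t$, $\bar N\in\mathcal{B}^{<\omega}$, $(\mu\alpha.M)\bar N\in\mathcal{T}_t$, $\mu\alpha.M[\alpha:=_r\bar N]\in\mathcal{B}\Rightarrow(\mu\alpha.M)\bar N\in\mathcal{B}$. For sets of terms $\mathcal{K},\mathcal{L}\subseteq\mathcal{B}$: $\mathcal{K}\leadsto\mathcal{L}=\{M\in\mathcal{B}\mid\forall N\in\mathcal{K},\ (M)N\in\mathcal{T}_t\Rightarrow(M)N\in\mathcal{L}\}$. For a set of sequences $\mathcal{X}\subseteq\mathcal{B}^{<\omega}$: $\mathcal{X}\leadsto\mathcal{B}=\{M\in\mathcal{B}\mid\forall\bar N\in\mathcal{X},\forall\bar P\sqsubseteq\bar N,\ (M)\bar P\in\mathcal{T}_t\Rightarrow(M)\bar P\in\mathcal{B}\}$. A set $\mathcal{S}\subseteq\mathcal{B}$ is $\mathcal{B}$-saturated if: (D1) for $M,N\in\mathcal{T}_t$, $\bar P\in\mathcal{T}_t^{<\omega}$ with $N\in\mathcal{B}$, $(\lambda x.M)N\bar P\in\mathcal{T}_t$ and $(M[x:=N])\bar P\in\mathcal{S}$, we have $(\lambda x.M)N\bar P\in\mathcal{S}$; (D2) for $n\ge0$, $N_1,\dots,N_n\in\mathcal{B}$, if $(x)N_1\dots N_n\in\mathcal{T}_t$ then it is in $\mathcal{S}$; (D3) there is $\mathcal{X}_{\mathcal{S}}\subseteq\mathcal{B}^{<\omega}$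 with $\mathcal{S}=\mathcal{X}_{\mathcal{S}}\leadsto\mathcal{B}$. Given a family $(\mathcal{S}_i)_{i\in I}$ of $\mathcal{B}$-saturated sets, the $\mathcal{B}$-model $\mathcal{M}$ is the smallest set containing $\mathcal{B}$ and all $\mathcal{S}_i$ and closed under $(\mathcal{U},\mathcal{V})\mapsto\mathcal{U}\leadsto\mathcal{V}$. For $\mathcal{S}\in\mathcal{M}$, $\mathcal{S}^{\mathcal{B}}=\bigcup\{\mathcal{X}\subseteq\mathcal{B}^{<\omega}\mid\mathcal{S}=\mathcal{X}\leadsto\mathcal{B}\}\cup\{\varnothing\}$ (a set of sequences, $\varnothing$ the empty sequence). An $\mathcal{M}$-interpretation is a map $\mathcal{I}$ from atomic types to $\mathcal{M}$, extended by $\mathcal{I}(\bot)=\mathcal{B}$ and $\mathcal{I}(A\to B)=\mathcal{I}(A)\leadsto\mathcal{I}(B)$. The simultaneous substitution $M\sigma$ for $\sigma=[(x_i:=M_i)_i;(\alpha_j:=_r\bar N_j)_j]$ replaces each $x_i$ by $M_i$ and, inductively, each subterm $[\alpha_j]U$ by $[\alpha_j](U\sigma)\bar N_j$ (subterms $[\alpha]U$ with $\alpha$ not among the $\alpha_j$ become $[\alpha]U\sigma$). *)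

theory Defs
  imports "HOL-Library.Finite_Map" "HOL-Library.Sublist"
begin

text \<open>
  Terms up to renaming of bound variables, with natural numbers as the names of the
  \<open>\<lambda>\<close>-variables and (separately) of the \<open>\<mu>\<close>-variables. A renaming class is represented by its
  de Bruijn term: below \<open>k\<close> binders of the relevant sort an index \<open>i < k\<close> is bound and an index
  \<open>i \<ge> k\<close> is the free variable with name \<open>i - k\<close>. Every value of the type is thus exactly one
  class. \<open>LamB\<close> and \<open>MuB\<close> are internal; the abstractions \<open>\<lambda>x. M\<close> and \<open>\<mu>\<alpha>. M\<close> over a
  \<^emph>\<open>named\<close> variable are the functions \<open>Lam x M\<close> and \<open>Mu \<alpha> M\<close> below, and typing and
  saturation are defined through these. This matters because saturated sets need not be closed under renaming of
  free variables.
\<close>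

datatype trm =
    Var nat
  | LamB trm
  | App trm trm
  | Nam nat trm  \<comment> \<open>\<open>[\<alpha>]M\<close>\<close>
  | MuB trm

primrec up :: "(nat \<Rightarrow> nat) \<Rightarrow> nat \<Rightarrow> nat" where
  "up f 0 = 0"
| "up f (Suc i) = Suc (f i)"

primrec ren :: "(nat \<Rightarrow> nat) \<Rightarrow> (nat \<Rightarrow> nat) \<Rightarrow> trm \<Rightarrow> trm" where
  "ren f g (Var x) = Var (f x)"
| "ren f g (LamB M) = LamB (ren (up f) g M)"
| "ren f g (App M N) = App (ren f g M) (ren f g N)"
| "ren f g (Nam \<alpha> M) = Nam (g \<alpha>) (ren f g M)"
| "ren f g (MuB M) = MuB (ren f (up g) M)"

definition bind_name :: "nat \<Rightarrow> nat \<Rightarrow> nat" where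
  "bind_name x i = (if i = x then 0 else Suc i)"

definition Lam :: "nat \<Rightarrow> trm \<Rightarrow> trm" where
  "Lam x M = LamB (ren (bind_name x) id M)"

definition Mu :: "nat \<Rightarrow> trm \<Rightarrow> trm" where
  "Mu \<alpha> M = MuB (ren id (bind_name \<alpha>) M)"

primrec fv :: "trm \<Rightarrow> nat set" where
  "fv (Var x) = {x}"
| "fv (LamB M) = {i. Suc i \<in> fv M}"
| "fv (App M N) = fv M \<union> fv N"
| "fv (Nam \<alpha> M) = fv M"
| "fv (MuB M) = fv M"

primrec fmv :: "trm \<Rightarrow> nat set" where
  "fmv (Var x) = {}"
| "fmv (LamB M) = fmv M"
| "fmv (App M N) = fmv M \<union> fmv N"
| "fmv (Nam \<alpha> M) = insert \<alpha> (fmv M)"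
| "fmv (MuB M) = {i. Suc i \<in> fmv M}"

definition apps :: "trm \<Rightarrow> trm list \<Rightarrow> trm" where
  "apps M Ps = foldl App M Ps"

text \<open>
  Simultaneous substitution: \<open>s x\<close> replaces \<open>x\<close>, and \<open>[\<alpha>]U\<close> becomes \<open>[\<alpha>](U\<sigma>)(r \<alpha>)\<close>.
  Variables not substituted for have \<open>s x = Var x\<close> and \<open>r \<alpha> = []\<close>.
\<close>

primrec up_s :: "(nat \<Rightarrow> trm) \<Rightarrow> nat \<Rightarrow> trm" where
  "up_s s 0 = Var 0"
| "up_s s (Suc i) = ren Suc id (s i)"

primrec up_r :: "(nat \<Rightarrow> trm list) \<Rightarrow> nat \<Rightarrow> trm list" where
  "up_r r 0 = []"
| "up_r r (Suc i) = map (ren id Suc) (r i)"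

primrec simsubst :: "(nat \<Rightarrow> trm) \<Rightarrow> (nat \<Rightarrow> trm list) \<Rightarrow> trm \<Rightarrow> trm" where
  "simsubst s r (Var x) = s x"
| "simsubst s r (LamB M) = LamB (simsubst (up_s s) (\<lambda>\<alpha>. map (ren Suc id) (r \<alpha>)) M)"
| "simsubst s r (App M N) = App (simsubst s r M) (simsubst s r N)"
| "simsubst s r (Nam \<alpha> M) = Nam \<alpha> (apps (simsubst s r M) (r \<alpha>))"
| "simsubst s r (MuB M) = MuB (simsubst (\<lambda>x. ren id Suc (s x)) (up_r r) M)"

text \<open>\<open>M[x := N]\<close>, \<open>M[\<alpha> :=\<^sub>r N]\<close> and \<open>M[\<alpha> :=\<^sub>r N\<^sub>1 \<dots> N\<^sub>n]\<close>.\<close>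

definition subst :: "trm \<Rightarrow> nat \<Rightarrow> trm \<Rightarrow> trm" where
  "subst M x N = simsubst (Var(x := N)) (\<lambda>_. []) M"

definition rsubst :: "trm \<Rightarrow> nat \<Rightarrow> trm \<Rightarrow> trm" where
  "rsubst M \<alpha> N = simsubst Var ((\<lambda>_. [])(\<alpha> := [N])) M"

definition rsubsts :: "trm \<Rightarrow> nat \<Rightarrow> trm list \<Rightarrow> trm" where
  "rsubsts M \<alpha> Ns = foldl (\<lambda>M' N. rsubst M' \<alpha> N) M Ns"

text \<open>
  The following facts confirm that the encoding behaves as named syntax up to renaming of
  bound variables, with capture-avoiding substitution.
\<close>

lemma ren_cong:
  "(\<And>x. x \<in> fv M \<Longrightarrow> f x = f' x) \<Longrightarrow> (\<And>\<alpha>. \<alpha> \<in> fmv M \<Longrightarrow> g \<alpha> = g' \<alpha>) \<Longrightarrow> ren f g M = ren f' g' M"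
proof (induction M arbitrary: f f' g g')
  case (Var x)
  then show ?case by simp
next
  case (LamB M)
  have "up f x = up f' x" if "x \<in> fv M" for x
    using that LamB.prems(1) by (cases x) auto
  then show ?case using LamB.IH[of "up f" "up f'" g g'] LamB.prems(2) by simp
next
  case (App M N)
  have "ren f g M = ren f' g' M" by (rule App.IH(1)) (simp_all add: App.prems)
  moreover have "ren f g N = ren f' g' N" by (rule App.IH(2)) (simp_all add: App.prems)
  ultimately show ?case by simp
next
  case (Nam \<alpha> M)
  have "ren f g M = ren f' g' M" by (rule Nam.IH) (simp_all add: Nam.prems)
  then show ?case by (simp add: Nam.prems(2))
next
  case (MuB M)
  have "up g x = up g' x" if "x \<in> fmv M" for x
    using that MuB.prems(2) by (cases x) auto
  then show ?case using MuB.IH[of f f' "up g" "up g'"] MuB.prems(1) by simp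
qed

lemma up_comp: "up f \<circ> up f' = up (f \<circ> f')"
proof
  show "(up f \<circ> up f') i = up (f \<circ> f') i" for i by (cases i) auto
qed

lemma up_id: "up id = id"
proof
  show "up id i = id i" for i by (cases i) auto
qed

lemma ren_ren: "ren f g (ren f' g' M) = ren (f \<circ> f') (g \<circ> g') M"
  by (induction M arbitrary: f f' g g') (auto simp: up_comp)

lemma ren_id: "ren id id M = M"
  by (induction M) (simp_all only: up_id ren.simps, simp_all)

lemma fv_ren: "fv (ren f g M) = f ` fv M"
proof (induction M arbitrary: f g)
  case (LamB M)
  have "Suc i \<in> up f ` fv M \<longleftrightarrow> (\<exists>j. Suc j \<in> fv M \<and> i = f j)" for i
  proof
    assume "Suc i \<in> up f ` fv M"
    then obtain k where "k \<in> fv M" "Suc i = up f k" by auto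
    then show "\<exists>j. Suc j \<in> fv M \<and> i = f j" by (cases k) auto
  next
    assume "\<exists>j. Suc j \<in> fv M \<and> i = f j"
    then obtain j where "Suc j \<in> fv M" "i = f j" by auto
    then show "Suc i \<in> up f ` fv M" by (intro image_eqI[of _ _ "Suc j"]) auto
  qed
  then show ?case using LamB.IH by auto
qed auto

lemma fmv_ren: "fmv (ren f g M) = g ` fmv M"
proof (induction M arbitrary: f g)
  case (MuB M)
  have "Suc i \<in> up g ` fmv M \<longleftrightarrow> (\<exists>j. Suc j \<in> fmv M \<and> i = g j)" for i
  proof
    assume "Suc i \<in> up g ` fmv M"
    then obtain k where "k \<in> fmv M" "Suc i = up g k" by auto
    then show "\<exists>j. Suc j \<in> fmv M \<and> i = g j" by (cases k) auto
  next
    assume "\<exists>j. Suc j \<in> fmv M \<and> i = g j"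
    then obtain j where "Suc j \<in> fmv M" "i = g j" by auto
    then show "Suc i \<in> up g ` fmv M" by (intro image_eqI[of _ _ "Suc j"]) auto
  qed
  then show ?case using MuB.IH by auto
qed auto

lemma fv_Lam: "fv (Lam x M) = fv M - {x}"
  by (auto simp: Lam_def fv_ren bind_name_def split: if_splits)

lemma fmv_Lam: "fmv (Lam x M) = fmv M"
  by (simp add: Lam_def fmv_ren)

lemma fv_Mu: "fv (Mu \<alpha> M) = fv M"
  by (simp add: Mu_def fv_ren)

lemma fmv_Mu: "fmv (Mu \<alpha> M) = fmv M - {\<alpha>}"
  by (auto simp: Mu_def fmv_ren bind_name_def split: if_splits)

lemma Lam_alpha: "y \<notin> fv M \<Longrightarrow> Lam y (ren (id(x := y)) id M) = Lam x M"
  unfolding Lam_def ren_ren by (auto simp: bind_name_def intro!: ren_cong)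

lemma Mu_alpha: "\<beta> \<notin> fmv M \<Longrightarrow> Mu \<beta> (ren id (id(\<alpha> := \<beta>)) M) = Mu \<alpha> M"
  unfolding Mu_def ren_ren by (auto simp: bind_name_def intro!: ren_cong)

lemma LamB_eq_Lam: "x \<notin> fv (LamB M) \<Longrightarrow> \<exists>M'. LamB M = Lam x M'"
proof -
  assume x: "x \<notin> fv (LamB M)"
  have "ren (bind_name x) id (ren (case_nat x id) id M) = ren id id M"
    unfolding ren_ren using x
    by (intro ren_cong) (auto simp: bind_name_def split: nat.splits)
  then show ?thesis unfolding Lam_def ren_id by metis
qed

lemma MuB_eq_Mu: "\<alpha> \<notin> fmv (MuB M) \<Longrightarrow> \<exists>M'. MuB M = Mu \<alpha> M'"
proof -
  assume x: "\<alpha> \<notin> fmv (MuB M)"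
  have "ren id (bind_name \<alpha>) (ren id (case_nat \<alpha> id) M) = ren id id M"
    unfolding ren_ren using x
    by (intro ren_cong) (auto simp: bind_name_def split: nat.splits)
  then show ?thesis unfolding Mu_def ren_id by metis
qed

lemma ren_apps: "ren f g (apps M Ps) = apps (ren f g M) (map (ren f g) Ps)"
  unfolding apps_def by (induction Ps arbitrary: M) auto

lemma ren_simsubst:
  assumes "\<And>x. s' (f x) = ren f g (s x)" and "\<And>\<alpha>. r' (g \<alpha>) = map (ren f g) (r \<alpha>)"
  shows "simsubst s' r' (ren f g M) = ren f g (simsubst s r M)"
  using assms
proof (induction M arbitrary: f g s s' r r')
  case (LamB M)
  have "up_s s' (up f x) = ren (up f) g (up_s s x)" for x
    by (cases x) (auto simp: LamB.prems(1) ren_ren intro!: ren_cong)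
  moreover have "map (ren Suc id) (r' (g \<alpha>)) = map (ren (up f) g) (map (ren Suc id) (r \<alpha>))" for \<alpha>
    by (auto simp: LamB.prems(2) ren_ren intro!: ren_cong)
  ultimately show ?case using LamB.IH by simp
next
  case (MuB M)
  have "up_r r' (up g \<alpha>) = map (ren f (up g)) (up_r r \<alpha>)" for \<alpha>
    by (cases \<alpha>) (auto simp: MuB.prems(2) ren_ren intro!: ren_cong)
  moreover have "ren id Suc (s' (f x)) = ren f (up g) (ren id Suc (s x))" for x
    by (auto simp: MuB.prems(1) ren_ren intro!: ren_cong)
  ultimately show ?case using MuB.IH by simp
next
  case (Var x)
  then show ?case by simp
next
  case (App M N)
  have "simsubst s' r' (ren f g M) = ren f g (simsubst s r M)"
    by (rule App.IH(1)) (rule App.prems)+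
  moreover have "simsubst s' r' (ren f g N) = ren f g (simsubst s r N)"
    by (rule App.IH(2)) (rule App.prems)+
  ultimately show ?case by simp
next
  case (Nam \<alpha> M)
  have "simsubst s' r' (ren f g M) = ren f g (simsubst s r M)"
    by (rule Nam.IH) (rule Nam.prems)+
  then show ?case by (simp add: ren_apps Nam.prems(2))
qed

lemma simsubst_Lam:
  assumes "s x = Var x" and "\<And>y. y \<noteq> x \<Longrightarrow> x \<notin> fv (s y)" and "\<And>\<alpha> P. P \<in> set (r \<alpha>) \<Longrightarrow> x \<notin> fv P"
  shows "simsubst s r (Lam x M) = Lam x (simsubst s r M)"
proof -
  have "up_s s (bind_name x y) = ren (bind_name x) id (s y)" for y
  proof (cases "y = x")
    case False
    then show ?thesis using assms(2)[OF False]
      by (auto simp: bind_name_def intro!: ren_cong)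
  qed (simp add: bind_name_def assms(1))
  moreover have "map (ren Suc id) (r (id \<alpha>)) = map (ren (bind_name x) id) (r \<alpha>)" for \<alpha>
    using assms(3) by (auto simp: bind_name_def intro!: ren_cong)
  ultimately show ?thesis unfolding Lam_def by (simp add: ren_simsubst)
qed

lemma simsubst_Mu:
  assumes "r \<alpha> = []" and "\<And>y. \<alpha> \<notin> fmv (s y)" and "\<And>\<beta> P. P \<in> set (r \<beta>) \<Longrightarrow> \<alpha> \<notin> fmv P"
  shows "simsubst s r (Mu \<alpha> M) = Mu \<alpha> (simsubst s r M)"
proof -
  have "up_r r (bind_name \<alpha> \<beta>) = map (ren id (bind_name \<alpha>)) (r \<beta>)" for \<beta>
  proof (cases "\<beta> = \<alpha>")
    case False
    then show ?thesis using assms(3)[of _ \<beta>]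
      by (auto simp: bind_name_def intro!: ren_cong)
  qed (simp add: bind_name_def assms(1))
  moreover have "ren id Suc (s (id x)) = ren id (bind_name \<alpha>) (s x)" for x
    using assms(2)[of x] by (auto simp: bind_name_def intro!: ren_cong)
  ultimately show ?thesis unfolding Mu_def by (simp add: ren_simsubst)
qed

datatype ty = Atom nat | Bot | Arr ty ty

type_synonym ctx = "(nat, ty) fmap"

inductive typing :: "ctx \<Rightarrow> trm \<Rightarrow> ty \<Rightarrow> ctx \<Rightarrow> bool" where
  ax: "fmlookup \<Gamma> x = Some A \<Longrightarrow> typing \<Gamma> (Var x) A \<Theta>"
| lam: "x |\<notin>| fmdom \<Gamma> \<Longrightarrow> typing (fmupd x A \<Gamma>) M B \<Theta> \<Longrightarrow> typing \<Gamma> (Lam x M) (Arr A B) \<Theta>"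
| app: "typing \<Gamma> M (Arr A B) \<Theta> \<Longrightarrow> typing \<Gamma> N A \<Theta> \<Longrightarrow> typing \<Gamma> (App M N) B \<Theta>"
| nam: "fmlookup \<Theta> \<alpha> = Some A \<Longrightarrow> typing \<Gamma> M A \<Theta> \<Longrightarrow> typing \<Gamma> (Nam \<alpha> M) Bot \<Theta>"
| mu: "\<alpha> |\<notin>| fmdom \<Theta> \<Longrightarrow> typing \<Gamma> M Bot (fmupd \<alpha> A \<Theta>) \<Longrightarrow> typing \<Gamma> (Mu \<alpha> M) A \<Theta>"

definition typable :: "trm set" where
  "typable = {M. \<exists>\<Gamma> A \<Theta>. typing \<Gamma> M A \<Theta>}"

text \<open>
  In the last clause the bound \<open>\<alpha>\<close> is chosen not free in \<open>Ns\<close>, as usual for terms up to renaming: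
  otherwise \<open>Mu \<alpha>\<close> would capture it in \<open>Mu \<alpha> (rsubsts M \<alpha> Ns)\<close>.
\<close>

definition saturated :: "trm set \<Rightarrow> bool" where
  "saturated \<B> \<longleftrightarrow>
     \<B> \<subseteq> typable \<and>
     (\<forall>x M. M \<in> \<B> \<longrightarrow> Lam x M \<in> \<B>) \<and>
     (\<forall>\<alpha> M. M \<in> \<B> \<and> Mu \<alpha> M \<in> typable \<longrightarrow> Mu \<alpha> M \<in> \<B>) \<and>
     (\<forall>\<alpha> M. M \<in> \<B> \<and> Nam \<alpha> M \<in> typable \<longrightarrow> Nam \<alpha> M \<in> \<B>) \<and>
     (\<forall>x Ns. Ns \<in> lists \<B> \<and> apps (Var x) Ns \<in> typable \<longrightarrow> apps (Var x) Ns \<in> \<B>) \<and>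
     (\<forall>x M N Ps. M \<in> typable \<and> N \<in> typable \<and> Ps \<in> lists typable \<and> N \<in> \<B> \<and>
        apps (App (Lam x M) N) Ps \<in> typable \<and> apps (subst M x N) Ps \<in> \<B> \<longrightarrow>
        apps (App (Lam x M) N) Ps \<in> \<B>) \<and>
     (\<forall>\<alpha> M Ns. M \<in> typable \<and> Ns \<in> lists \<B> \<and> (\<forall>N\<in>set Ns. \<alpha> \<notin> fmv N) \<and>
        apps (Mu \<alpha> M) Ns \<in> typable \<and> Mu \<alpha> (rsubsts M \<alpha> Ns) \<in> \<B> \<longrightarrow>
        apps (Mu \<alpha> M) Ns \<in> \<B>)"

definition arrow :: "trm set \<Rightarrow> trm set \<Rightarrow> trm set \<Rightarrow> trm set" where
  "arrow \<B> K L = {M \<in> \<B>. \<forall>N\<in>K. App M N \<in> typable \<longrightarrow> App M N \<in> L}"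

definition seq_arrow :: "trm set \<Rightarrow> trm list set \<Rightarrow> trm set" where
  "seq_arrow \<B> \<X> =
     {M \<in> \<B>. \<forall>Ns\<in>\<X>. \<forall>Ps. prefix Ps Ns \<longrightarrow> apps M Ps \<in> typable \<longrightarrow> apps M Ps \<in> \<B>}"

definition rel_saturated :: "trm set \<Rightarrow> trm set \<Rightarrow> bool" where
  "rel_saturated \<B> \<S> \<longleftrightarrow>
     \<S> \<subseteq> \<B> \<and>
     (\<forall>x M N Ps. M \<in> typable \<and> N \<in> typable \<and> Ps \<in> lists typable \<and> N \<in> \<B> \<and>
        apps (App (Lam x M) N) Ps \<in> typable \<and> apps (subst M x N) Ps \<in> \<S> \<longrightarrow>
        apps (App (Lam x M) N) Ps \<in> \<S>) \<and>
     (\<forall>x Ns. Ns \<in> lists \<B> \<and> apps (Var x) Ns \<in> typable \<longrightarrow> apps (Var x) Ns \<in> \<S>) \<and>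
     (\<exists>\<X> \<subseteq> lists \<B>. \<S> = seq_arrow \<B> \<X>)"

inductive_set model :: "trm set \<Rightarrow> 'i set \<Rightarrow> ('i \<Rightarrow> trm set) \<Rightarrow> trm set set"
  for \<B> :: "trm set" and J :: "'i set" and \<S> :: "'i \<Rightarrow> trm set" where
  base: "\<B> \<in> model \<B> J \<S>"
| family: "i \<in> J \<Longrightarrow> \<S> i \<in> model \<B> J \<S>"
| arrow: "U \<in> model \<B> J \<S> \<Longrightarrow> V \<in> model \<B> J \<S> \<Longrightarrow> arrow \<B> U V \<in> model \<B> J \<S>"

definition seqs :: "trm set \<Rightarrow> trm set \<Rightarrow> trm list set" where
  "seqs \<B> \<S> = \<Union>{\<X>. \<X> \<subseteq> lists \<B> \<and> \<S> = seq_arrow \<B> \<X>} \<union> {[]}"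

primrec interp :: "trm set \<Rightarrow> (nat \<Rightarrow> trm set) \<Rightarrow> ty \<Rightarrow> trm set" where
  "interp \<B> \<I> (Atom X) = \<I> X"
| "interp \<B> \<I> Bot = \<B>"
| "interp \<B> \<I> (Arr A B) = arrow \<B> (interp \<B> \<I> A) (interp \<B> \<I> B)"

end

theory Submission imports Defs begin

text \<open>
  Every set \<open>\<U>\<close> of the model is again \<open>\<B>\<close>-saturated, in particular of the form \<open>\<X> \<leadsto> \<B>\<close>: if
  \<open>\<V> = \<X> \<leadsto> \<B>\<close> then \<open>\<U> \<leadsto> \<V>\<close> is obtained from the sequences \<open>N \<cdot> Ns\<close> with \<open>N \<in> \<U>\<close> and
  \<open>Ns \<in> \<X> \<union> {\<emptyset>}\<close>. The theorem follows by induction on the size of \<open>M\<close>, the size being used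
  because bound variables have to be chosen fresh for the substitution. For an abstraction
  \<open>\<lambda>x. M\<close>, expansion reduces membership of \<open>(\<lambda>x. M\<sigma>)N\<close> to that of \<open>M\<sigma>[x := N]\<close>. For
  \<open>\<mu>\<alpha>. M\<close> of type \<open>A\<close> with \<open>\<I>(A) = \<X> \<leadsto> \<B>\<close>, clause (C6) reduces membership of \<open>(\<mu>\<alpha>. M\<sigma>)Ps\<close>,
  where \<open>Ps\<close> is an initial segment of a sequence in \<open>\<X>\<close>, to that of \<open>\<mu>\<alpha>. M\<sigma>[\<alpha> := Ps]\<close>, and
  \<open>\<sigma>[\<alpha> := Ps]\<close> is again a substitution to which the induction hypothesis applies. The typability
  side conditions are instances of the substitution lemma for typing.
\<close>

subsection \<open>Simultaneous substitution\<close>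

lemma apps_simps [simp]:
  "apps M [] = M"
  "apps M (P # Ps) = apps (App M P) Ps"
  "apps M (Ps @ Qs) = apps (apps M Ps) Qs"
  by (simp_all add: apps_def)

lemma simsubst_apps: "simsubst s r (apps M Ps) = apps (simsubst s r M) (map (simsubst s r) Ps)"
  by (induction Ps arbitrary: M) auto

lemma simsubst_cong:
  assumes "\<And>x. x \<in> fv M \<Longrightarrow> s x = s' x" and "\<And>\<alpha>. \<alpha> \<in> fmv M \<Longrightarrow> r \<alpha> = r' \<alpha>"
  shows "simsubst s r M = simsubst s' r' M"
  using assms
proof (induction M arbitrary: s s' r r')
  case (LamB M)
  have "up_s s x = up_s s' x" if "x \<in> fv M" for x
    using that LamB.prems(1) by (cases x) auto
  then show ?case using LamB.prems(2) by (auto intro!: LamB.IH)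
next
  case (App M N)
  have "simsubst s r M = simsubst s' r' M" by (rule App.IH(1)) (simp_all add: App.prems)
  moreover have "simsubst s r N = simsubst s' r' N" by (rule App.IH(2)) (simp_all add: App.prems)
  ultimately show ?case by simp
next
  case (Nam \<alpha> M)
  have "simsubst s r M = simsubst s' r' M" by (rule Nam.IH) (simp_all add: Nam.prems)
  then show ?case by (simp add: Nam.prems(2))
next
  case (MuB M)
  have "up_r r x = up_r r' x" if "x \<in> fmv M" for x
    using that MuB.prems(2) by (cases x) auto
  then show ?case using MuB.prems(1) by (auto intro!: MuB.IH)
qed simp

lemma simsubst_Var_Nil: "simsubst Var (\<lambda>_. []) M = M"
proof (induction M)
  case (LamB M)
  have "up_s Var = Var"
  proof
    show "up_s Var i = Var i" for i by (cases i) auto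
  qed
  then show ?case using LamB by simp
next
  case (MuB M)
  have "up_r (\<lambda>_. []) = (\<lambda>_. [])"
  proof
    show "up_r (\<lambda>_. []) i = []" for i by (cases i) auto
  qed
  then show ?case using MuB by simp
qed simp_all

lemma simsubst_fresh:
  assumes "\<And>x. x \<in> fv M \<Longrightarrow> s x = Var x" and "\<And>\<alpha>. \<alpha> \<in> fmv M \<Longrightarrow> r \<alpha> = []"
  shows "simsubst s r M = M"
  using simsubst_cong[of M s Var r "\<lambda>_. []"] assms by (simp add: simsubst_Var_Nil)

text \<open>The first substitution turns \<open>[\<alpha>]U\<close> into \<open>[\<alpha>]\<close>
  of \<open>U\<close> applied to \<open>r \<alpha>\<close>. The second one acts inside those
  arguments and then supplies \<open>r' \<alpha>\<close> after them, which gives the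
  concatenation.\<close>

lemma simsubst_simsubst:
  "simsubst s' r' (simsubst s r M) =
     simsubst (\<lambda>x. simsubst s' r' (s x)) (\<lambda>\<alpha>. map (simsubst s' r') (r \<alpha>) @ r' \<alpha>) M"
proof (induction M arbitrary: s s' r r')
  case (LamB M)
  have shift: "simsubst (up_s s') (\<lambda>\<alpha>. map (ren Suc id) (r' \<alpha>)) (ren Suc id t) =
      ren Suc id (simsubst s' r' t)" for t
    by (rule ren_simsubst) auto
  have "(\<lambda>x. simsubst (up_s s') (\<lambda>\<alpha>. map (ren Suc id) (r' \<alpha>)) (up_s s x)) =
      up_s (\<lambda>x. simsubst s' r' (s x))"
  proof
    show "simsubst (up_s s') (\<lambda>\<alpha>. map (ren Suc id) (r' \<alpha>)) (up_s s x) =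
      up_s (\<lambda>x. simsubst s' r' (s x)) x" for x
      by (cases x) (simp_all add: shift)
  qed
  then show ?case by (simp add: LamB.IH shift comp_def)
next
  case (MuB M)
  have shift: "simsubst (\<lambda>x. ren id Suc (s' x)) (up_r r') (ren id Suc t) =
      ren id Suc (simsubst s' r' t)" for t
    by (rule ren_simsubst) auto
  have "(\<lambda>\<alpha>. map (simsubst (\<lambda>x. ren id Suc (s' x)) (up_r r')) (up_r r \<alpha>) @ up_r r' \<alpha>) =
      up_r (\<lambda>\<alpha>. map (simsubst s' r') (r \<alpha>) @ r' \<alpha>)"
  proof
    show "map (simsubst (\<lambda>x. ren id Suc (s' x)) (up_r r')) (up_r r \<alpha>) @ up_r r' \<alpha> =
      up_r (\<lambda>\<alpha>. map (simsubst s' r') (r \<alpha>) @ r' \<alpha>) \<alpha>" for \<alpha>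
      by (cases \<alpha>) (simp_all add: shift)
  qed
  then show ?case by (simp add: MuB.IH shift)
qed (simp_all add: simsubst_apps)

text \<open>Since \<open>x\<close> occurs in no inserted term, the later substitution only reaches
  the occurrences of \<open>x\<close> left by \<open>s\<close>. This turns the contractum of a beta
  redex into an instance of one extended substitution.\<close>

lemma subst_simsubst:
  assumes "s x = Var x" and "\<And>y. y \<noteq> x \<Longrightarrow> x \<notin> fv (s y)" and "\<And>\<alpha> P. P \<in> set (r \<alpha>) \<Longrightarrow> x \<notin> fv P"
  shows "subst (simsubst s r M) x N = simsubst (s(x := N)) r M"
proof -
  have fresh: "simsubst (Var(x := N)) (\<lambda>_. []) t = t" if "x \<notin> fv t" for t
    using that by (intro simsubst_fresh) auto
  have "map (simsubst (Var(x := N)) (\<lambda>_. [])) (r \<alpha>) = r \<alpha>" for \<alpha>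
    using assms(3) by (simp add: fresh map_idI)
  moreover have "simsubst (Var(x := N)) (\<lambda>_. []) (s y) = (s(x := N)) y" for y
    using assms(1,2) by (cases "y = x") (simp_all add: fresh)
  ultimately show ?thesis
    unfolding subst_def simsubst_simsubst by (simp only: append_Nil2)
qed

text \<open>The single-argument substitutions merge into one because \<alpha> is free in none of the
  inserted terms: a later step leaves earlier arguments unchanged and only appends its own.\<close>

lemma rsubsts_simsubst:
  assumes "r \<alpha> = []" and "\<And>y. \<alpha> \<notin> fmv (s y)" and "\<And>\<beta> P. P \<in> set (r \<beta>) \<Longrightarrow> \<alpha> \<notin> fmv P"
    and "\<And>P. P \<in> set Ps \<Longrightarrow> \<alpha> \<notin> fmv P"
  shows "rsubsts (simsubst s r M) \<alpha> Ps = simsubst s (r(\<alpha> := Ps)) M"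
  using assms(4)
\<comment> \<open>\<open>rsubsts\<close> is a left fold, so the last argument is substituted last;
  the induction therefore peels off the end of the list.\<close>
proof (induction Ps rule: rev_induct)
  case Nil
  have "r(\<alpha> := []) = r" using assms(1) by auto
  then show ?case by (simp add: rsubsts_def)
next
  case (snoc P Ps)
  let ?r = "(\<lambda>_. [])(\<alpha> := [P])"
  have fresh: "simsubst Var ?r t = t" if "\<alpha> \<notin> fmv t" for t
    using that by (intro simsubst_fresh) auto
  have "map (simsubst Var ?r) ((r(\<alpha> := Ps)) \<beta>) @ ?r \<beta> = (r(\<alpha> := Ps @ [P])) \<beta>" for \<beta>
    using assms(3)[of _ \<beta>] snoc.prems by (auto simp: fresh map_idI)
  moreover have "rsubsts (simsubst s r M) \<alpha> (Ps @ [P]) =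
      rsubst (simsubst s (r(\<alpha> := Ps)) M) \<alpha> P"
  proof -
    have "rsubsts (simsubst s r M) \<alpha> Ps = simsubst s (r(\<alpha> := Ps)) M"
      using snoc.prems by (intro snoc.IH) simp
    then show ?thesis by (simp only: rsubsts_def foldl_append foldl.simps)
  qed
  ultimately show ?case
    unfolding rsubst_def simsubst_simsubst by (simp only: fresh[OF assms(2)])
qed

corollary rsubsts_eq_simsubst:
  assumes "\<And>P. P \<in> set Ps \<Longrightarrow> \<alpha> \<notin> fmv P"
  shows "rsubsts M \<alpha> Ps = simsubst Var ((\<lambda>_. [])(\<alpha> := Ps)) M"
  using rsubsts_simsubst[of "\<lambda>_. []" \<alpha> Var Ps M] assms by (simp add: simsubst_Var_Nil)

section \<open>Sizes, finiteness of free variables, and opening of binders\<close>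

lemma size_ren: "size (ren f g M) = size M"
  by (induction M arbitrary: f g) auto

lemma finite_fv: "finite (fv M)"
proof (induction M)
  case (LamB M)
  have "{i. Suc i \<in> fv M} = Suc -` fv M" by auto
  then show ?case using LamB by (simp add: finite_vimageI)
qed auto

lemma finite_fmv: "finite (fmv M)"
proof (induction M)
  case (MuB M)
  have "{i. Suc i \<in> fmv M} = Suc -` fmv M" by auto
  then show ?case using MuB by (simp add: finite_vimageI)
qed auto

text \<open>The renaming \<open>case_nat x id\<close> opens the binder at the name \<open>x\<close>
  and is undone by \<open>bind_name x\<close>. Giving the body explicitly makes its size known, as
  induction on size requires.\<close>

lemma LamB_eq_Lam_ren: "x \<notin> fv (LamB M) \<Longrightarrow> LamB M = Lam x (ren (case_nat x id) id M)"
proof -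
  assume x: "x \<notin> fv (LamB M)"
  have "ren (bind_name x) id (ren (case_nat x id) id M) = ren id id M"
    unfolding ren_ren using x
    by (intro ren_cong) (auto simp: bind_name_def split: nat.splits)
  then show ?thesis by (simp add: Lam_def ren_id)
qed

lemma MuB_eq_Mu_ren: "\<alpha> \<notin> fmv (MuB M) \<Longrightarrow> MuB M = Mu \<alpha> (ren id (case_nat \<alpha> id) M)"
proof -
  assume x: "\<alpha> \<notin> fmv (MuB M)"
  have "ren id (bind_name \<alpha>) (ren id (case_nat \<alpha> id) M) = ren id id M"
    unfolding ren_ren using x
    by (intro ren_cong) (auto simp: bind_name_def split: nat.splits)
  then show ?thesis by (simp add: Mu_def ren_id)
qed

subsection \<open>Typing of de Bruijn terms\<close>

text \<open>Follows the datatype constructors, so inductions involve no choice of names. Entering a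
  binder puts its type at index 0 and shifts the context, which is easiest with partial
  functions.\<close>

inductive dbtyping :: "(nat \<Rightarrow> ty option) \<Rightarrow> trm \<Rightarrow> ty \<Rightarrow> (nat \<Rightarrow> ty option) \<Rightarrow> bool" where
  Var: "G x = Some A \<Longrightarrow> dbtyping G (Var x) A H"
| LamB: "dbtyping (case_nat (Some A) G) M B H \<Longrightarrow> dbtyping G (LamB M) (Arr A B) H"
| App: "dbtyping G M (Arr A B) H \<Longrightarrow> dbtyping G N A H \<Longrightarrow> dbtyping G (App M N) B H"
| Nam: "H \<alpha> = Some A \<Longrightarrow> dbtyping G M A H \<Longrightarrow> dbtyping G (Nam \<alpha> M) Bot H"
| MuB: "dbtyping G M Bot (case_nat (Some A) H) \<Longrightarrow> dbtyping G (MuB M) A H"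

inductive_cases dbtyping_LamE: "dbtyping G (LamB M) A H"
inductive_cases dbtyping_AppE: "dbtyping G (App M N) A H"
inductive_cases dbtyping_NamE: "dbtyping G (Nam \<alpha> M) A H"
inductive_cases dbtyping_MuE: "dbtyping G (MuB M) A H"

text \<open>Asking for agreement of the contexts on free variables alone covers renaming, weakening
  and strengthening at once.\<close>

lemma dbtyping_ren:
  assumes "dbtyping G M A H"
    and "\<And>x. x \<in> fv M \<Longrightarrow> G' (f x) = G x" and "\<And>\<alpha>. \<alpha> \<in> fmv M \<Longrightarrow> H' (g \<alpha>) = H \<alpha>"
  shows "dbtyping G' (ren f g M) A H'"
  using assms
proof (induction arbitrary: f g G' H' rule: dbtyping.induct)
  case (LamB A G M B H)
  have "case_nat (Some A) G' (up f x) = case_nat (Some A) G x" if "x \<in> fv M" for x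
    using that LamB.prems(1) by (cases x) auto
  then show ?case using LamB.prems(2) by (auto intro!: dbtyping.LamB LamB.IH)
next
  case (MuB G M A H)
  have "case_nat (Some A) H' (up g x) = case_nat (Some A) H x" if "x \<in> fmv M" for x
    using that MuB.prems(2) by (cases x) auto
  then show ?case using MuB.prems(1) by (auto intro!: dbtyping.MuB MuB.IH)
next
  case (App G M A B H N)
  have "dbtyping G' (ren f g M) (Arr A B) H'" by (rule App.IH(1)) (simp_all add: App.prems)
  moreover have "dbtyping G' (ren f g N) A H'" by (rule App.IH(2)) (simp_all add: App.prems)
  ultimately show ?case by (auto intro: dbtyping.App)
qed (auto intro: dbtyping.intros)

lemma dbtyping_Lam_iff:
  "dbtyping G (Lam x M) C H \<longleftrightarrow> (\<exists>A B. C = Arr A B \<and> dbtyping (G(x := Some A)) M B H)"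
proof
  assume "dbtyping G (Lam x M) C H"
  then obtain A B where C: "C = Arr A B"
    and M: "dbtyping (case_nat (Some A) G) (ren (bind_name x) id M) B H"
    unfolding Lam_def by (auto elim: dbtyping_LamE)
  \<comment> \<open>The contexts disagree at most at index \<open>Suc x\<close>, which is not in the
    image of \<open>bind_name x\<close> and hence not free in the renamed body.\<close>
  have "dbtyping (G(x := Some A)) (ren (case_nat x id) id (ren (bind_name x) id M)) B H"
    using M by (rule dbtyping_ren) (auto simp: fv_ren bind_name_def split: if_splits)
  moreover have "ren (case_nat x id) id (ren (bind_name x) id M) = ren id id M"
    unfolding ren_ren by (rule ren_cong) (auto simp: bind_name_def)
  ultimately show "\<exists>A B. C = Arr A B \<and> dbtyping (G(x := Some A)) M B H"
    using C by (auto simp: ren_id)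
next
  assume "\<exists>A B. C = Arr A B \<and> dbtyping (G(x := Some A)) M B H"
  then show "dbtyping G (Lam x M) C H"
    unfolding Lam_def by (auto intro!: dbtyping.LamB elim!: dbtyping_ren simp: bind_name_def)
qed

lemma dbtyping_Mu_iff:
  "dbtyping G (Mu \<alpha> M) A H \<longleftrightarrow> dbtyping G M Bot (H(\<alpha> := Some A))"
proof
  assume "dbtyping G (Mu \<alpha> M) A H"
  then have M: "dbtyping G (ren id (bind_name \<alpha>) M) Bot (case_nat (Some A) H)"
    unfolding Mu_def by (auto elim: dbtyping_MuE)
  have "dbtyping G (ren id (case_nat \<alpha> id) (ren id (bind_name \<alpha>) M)) Bot (H(\<alpha> := Some A))"
    using M by (rule dbtyping_ren) (auto simp: fmv_ren bind_name_def split: if_splits)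
  moreover have "ren id (case_nat \<alpha> id) (ren id (bind_name \<alpha>) M) = ren id id M"
    unfolding ren_ren by (rule ren_cong) (auto simp: bind_name_def)
  ultimately show "dbtyping G M Bot (H(\<alpha> := Some A))"
    by (auto simp: ren_id)
next
  assume "dbtyping G M Bot (H(\<alpha> := Some A))"
  then show "dbtyping G (Mu \<alpha> M) A H"
    unfolding Mu_def by (auto intro!: dbtyping.MuB elim!: dbtyping_ren simp: bind_name_def)
qed

lemma fmlookup_fmupd_eq: "fmlookup (fmupd x A \<Gamma>) = (fmlookup \<Gamma>)(x := Some A)"
  by (rule ext) simp

lemma dbtyping_if_typing: "typing \<Gamma> M A \<Theta> \<Longrightarrow> dbtyping (fmlookup \<Gamma>) M A (fmlookup \<Theta>)"
  by (induction rule: typing.induct)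
    (auto intro: dbtyping.intros simp: dbtyping_Lam_iff dbtyping_Mu_iff fmlookup_fmupd_eq
      simp del: fmupd_lookup fun_upd_apply)

text \<open>The renaming is part of the statement because each binder is opened at a fresh name: the
  body is then needed with index 0 sent to that name.\<close>

lemma typing_ren_if_dbtyping:
  assumes "dbtyping G M A H"
    and "\<And>x C. G x = Some C \<Longrightarrow> fmlookup \<Gamma> (f x) = Some C"
    and "\<And>\<alpha> C. H \<alpha> = Some C \<Longrightarrow> fmlookup \<Theta> (g \<alpha>) = Some C"
  shows "typing \<Gamma> (ren f g M) A \<Theta>"
  using assms
proof (induction arbitrary: f g \<Gamma> \<Theta> rule: dbtyping.induct)
  case (LamB A G M B H)
  \<comment> \<open>Avoiding the context serves the side condition of \<open>typing.lam\<close>;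
    avoiding the free variables allows the abstraction to be opened at \<open>x\<close>.\<close>
  obtain x where x: "x \<notin> fset (fmdom \<Gamma>) \<union> fv (ren f g (LamB M))"
    using ex_new_if_finite[OF infinite_UNIV_nat] finite_fv by (metis finite_Un finite_fset)
  let ?f = "case_nat x id \<circ> up f"
  have "typing (fmupd x A \<Gamma>) (ren ?f g M) B \<Theta>"
  proof (rule LamB.IH)
    fix y C assume y: "case_nat (Some A) G y = Some C"
    show "fmlookup (fmupd x A \<Gamma>) (?f y) = Some C"
    proof (cases y)
      case (Suc i)
      then have "fmlookup \<Gamma> (f i) = Some C" using y LamB.prems(1) by simp
      moreover from this have "f i \<noteq> x" using x by (auto intro: fmdomI)
      ultimately show ?thesis using Suc by simp
    qed (use y in simp)
  qed (rule LamB.prems(2))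
  moreover have "ren f g (LamB M) = Lam x (ren ?f g M)"
    using LamB_eq_Lam_ren[of x "ren (up f) g M"] x by (simp add: ren_ren)
  ultimately show ?case using x by (auto intro: typing.lam)
next
  case (MuB G M A H)
  obtain \<alpha> where \<alpha>: "\<alpha> \<notin> fset (fmdom \<Theta>) \<union> fmv (ren f g (MuB M))"
    using ex_new_if_finite[OF infinite_UNIV_nat] finite_fmv by (metis finite_Un finite_fset)
  let ?g = "case_nat \<alpha> id \<circ> up g"
  have "typing \<Gamma> (ren f ?g M) Bot (fmupd \<alpha> A \<Theta>)"
  proof (rule MuB.IH)
    fix y C assume y: "case_nat (Some A) H y = Some C"
    show "fmlookup (fmupd \<alpha> A \<Theta>) (?g y) = Some C"
    proof (cases y)
      case (Suc i)
      then have "fmlookup \<Theta> (g i) = Some C" using y MuB.prems(2) by simp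
      moreover from this have "g i \<noteq> \<alpha>" using \<alpha> by (auto intro: fmdomI)
      ultimately show ?thesis using Suc by simp
    qed (use y in simp)
  qed (rule MuB.prems(1))
  moreover have "ren f g (MuB M) = Mu \<alpha> (ren f ?g M)"
    using MuB_eq_Mu_ren[of \<alpha> "ren f (up g) M"] \<alpha> by (simp add: ren_ren)
  ultimately show ?case using \<alpha> by (auto intro: typing.mu)
next
  case (App G M A B H N)
  have "typing \<Gamma> (ren f g M) (Arr A B) \<Theta>" by (rule App.IH(1)) (simp_all add: App.prems)
  moreover have "typing \<Gamma> (ren f g N) A \<Theta>" by (rule App.IH(2)) (simp_all add: App.prems)
  ultimately show ?case by (auto intro: typing.app)
qed (auto intro: typing.intros)

lemma typing_iff_dbtyping: "typing \<Gamma> M A \<Theta> \<longleftrightarrow> dbtyping (fmlookup \<Gamma>) M A (fmlookup \<Theta>)"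
  using dbtyping_if_typing typing_ren_if_dbtyping[of _ M A _ \<Gamma> id \<Theta> id]
  by (auto simp: ren_id)

text \<open>Where \<open>x\<close> is already declared in \<Gamma>, \<open>fmupd\<close> overwrites
  the entry. The freshness demanded by rule \<open>lam\<close> is recovered by the passage through
  de Bruijn typing, which renames the bound variable.\<close>

lemma typing_Lam_iff:
  "typing \<Gamma> (Lam x M) C \<Theta> \<longleftrightarrow> (\<exists>A B. C = Arr A B \<and> typing (fmupd x A \<Gamma>) M B \<Theta>)"
  by (simp add: typing_iff_dbtyping dbtyping_Lam_iff fmlookup_fmupd_eq)

lemma typing_Mu_iff: "typing \<Gamma> (Mu \<alpha> M) A \<Theta> \<longleftrightarrow> typing \<Gamma> M Bot (fmupd \<alpha> A \<Theta>)"
  by (simp add: typing_iff_dbtyping dbtyping_Mu_iff fmlookup_fmupd_eq)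

lemma typing_App_iff:
  "typing \<Gamma> (App M N) B \<Theta> \<longleftrightarrow> (\<exists>A. typing \<Gamma> M (Arr A B) \<Theta> \<and> typing \<Gamma> N A \<Theta>)"
  by (auto simp: typing_iff_dbtyping intro: dbtyping.intros elim: dbtyping_AppE)

lemma typing_Nam_iff:
  "typing \<Gamma> (Nam \<alpha> M) B \<Theta> \<longleftrightarrow> B = Bot \<and> (\<exists>A. fmlookup \<Theta> \<alpha> = Some A \<and> typing \<Gamma> M A \<Theta>)"
  by (auto simp: typing_iff_dbtyping intro: dbtyping.intros elim: dbtyping_NamE)

lemma typing_Var_iff: "typing \<Gamma> (Var x) A \<Theta> \<longleftrightarrow> fmlookup \<Gamma> x = Some A"
  by (auto simp: typing_iff_dbtyping intro: dbtyping.intros elim: dbtyping.cases)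

section \<open>Argument sequences and the substitution lemma\<close>

text \<open>\<open>C\<close> is the type of a head to which \<open>Ps\<close> is applied and
  \<open>D\<close> the type of the result; keeping the two apart lets the head be replaced by
  another of type \<open>C\<close>.\<close>

primrec spine_typing ::
    "(nat \<Rightarrow> ty option) \<Rightarrow> (nat \<Rightarrow> ty option) \<Rightarrow> trm list \<Rightarrow> ty \<Rightarrow> ty \<Rightarrow> bool" where
  "spine_typing G H [] C D \<longleftrightarrow> C = D"
| "spine_typing G H (P # Ps) C D \<longleftrightarrow>
     (\<exists>A B. C = Arr A B \<and> dbtyping G P A H \<and> spine_typing G H Ps B D)"

lemma dbtyping_apps_iff:
  "dbtyping G (apps M Ps) D H \<longleftrightarrow> (\<exists>C. dbtyping G M C H \<and> spine_typing G H Ps C D)"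
proof (induction Ps arbitrary: M)
  case (Cons P Ps)
  have "dbtyping G (App M P) B H \<longleftrightarrow> (\<exists>A. dbtyping G M (Arr A B) H \<and> dbtyping G P A H)" for B
    by (auto intro: dbtyping.App elim: dbtyping_AppE)
  then show ?case by (auto simp: Cons.IH)
qed simp

lemma spine_typing_ren:
  assumes "spine_typing G H Ps C D"
    and "\<And>P x. P \<in> set Ps \<Longrightarrow> x \<in> fv P \<Longrightarrow> G' (f x) = G x"
    and "\<And>P \<alpha>. P \<in> set Ps \<Longrightarrow> \<alpha> \<in> fmv P \<Longrightarrow> H' (g \<alpha>) = H \<alpha>"
  shows "spine_typing G' H' (map (ren f g) Ps) C D"
  using assms
proof (induction Ps arbitrary: C)
  case (Cons P Ps)
  then obtain A B where AB: "C = Arr A B" "dbtyping G P A H" "spine_typing G H Ps B D" by auto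
  have "dbtyping G' (ren f g P) A H'"
    using AB(2) by (rule dbtyping_ren) (auto intro: Cons.prems)
  moreover have "spine_typing G' H' (map (ren f g) Ps) B D"
    using AB(3) by (rule Cons.IH) (auto intro: Cons.prems)
  ultimately show ?case using AB(1) by simp
qed simp

text \<open>Structural substitution may change the type of \<alpha>: an argument of
  \<open>[\<alpha>]\<close> of type \<open>C\<close> gets applied to \<open>r \<alpha>\<close> and
  then has type \<open>D\<close>, while the named term keeps type \<open>Bot\<close>.\<close>

lemma dbtyping_simsubst:
  assumes "dbtyping G M A H"
    and "\<And>x C. G x = Some C \<Longrightarrow> dbtyping G' (s x) C H'"
    and "\<And>\<alpha> C. H \<alpha> = Some C \<Longrightarrow> \<exists>D. H' \<alpha> = Some D \<and> spine_typing G' H' (r \<alpha>) C D"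
  shows "dbtyping G' (simsubst s r M) A H'"
  using assms
proof (induction arbitrary: s r G' H' rule: dbtyping.induct)
  case (Var G x A H)
  then show ?case by simp
next
  case (LamB A G M B H)
  let ?G = "case_nat (Some A) G'"
  have "dbtyping ?G (simsubst (up_s s) (\<lambda>\<alpha>. map (ren Suc id) (r \<alpha>)) M) B H'"
  proof (rule LamB.IH)
    show "dbtyping ?G (up_s s x) C H'" if "case_nat (Some A) G x = Some C" for x C
      using that LamB.prems(1)
      by (cases x) (auto intro: dbtyping.Var dbtyping_ren[where G = G' and H = H'])
    show "\<exists>D. H' \<alpha> = Some D \<and> spine_typing ?G H' (map (ren Suc id) (r \<alpha>)) C D"
      if "H \<alpha> = Some C" for \<alpha> C
      using LamB.prems(2)[OF that] by (auto elim!: spine_typing_ren)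
  qed
  then show ?case by (simp add: dbtyping.LamB)
next
  case (MuB G M A H)
  let ?H = "case_nat (Some A) H'"
  have "dbtyping G' (simsubst (\<lambda>x. ren id Suc (s x)) (up_r r) M) Bot ?H"
  proof (rule MuB.IH)
    show "dbtyping G' (ren id Suc (s x)) C ?H" if "G x = Some C" for x C
      using MuB.prems(1)[OF that] by (rule dbtyping_ren) auto
    \<comment> \<open>At index 0 the sequence is empty, so the newly bound variable keeps its type;
      the other indices are shifted.\<close>
    show "\<exists>D. ?H \<alpha> = Some D \<and> spine_typing G' ?H (up_r r \<alpha>) C D"
      if "case_nat (Some A) H \<alpha> = Some C" for \<alpha> C
      using that MuB.prems(2) by (cases \<alpha>) (fastforce elim!: spine_typing_ren)+
  qed
  then show ?case by (simp add: dbtyping.MuB)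
next
  case (App G M A B H N)
  have "dbtyping G' (simsubst s r M) (Arr A B) H'" by (rule App.IH(1)) (simp_all add: App.prems)
  moreover have "dbtyping G' (simsubst s r N) A H'" by (rule App.IH(2)) (simp_all add: App.prems)
  ultimately show ?case by (auto intro: dbtyping.App)
next
  case (Nam H \<alpha> A G M)
  have "dbtyping G' (simsubst s r M) A H'" by (rule Nam.IH) (simp_all add: Nam.prems)
  then show ?case using Nam.prems(2)[OF Nam.hyps(1)]
    by (auto intro!: dbtyping.Nam simp: dbtyping_apps_iff)
qed

subsection \<open>Typable terms\<close>

lemma typable_iff: "M \<in> typable \<longleftrightarrow> (\<exists>\<Gamma> A \<Theta>. dbtyping (fmlookup \<Gamma>) M A (fmlookup \<Theta>))"
  by (simp add: typable_def typing_iff_dbtyping)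

lemma typableE:
  assumes "M \<in> typable"
  obtains \<Gamma> A \<Theta> where "typing \<Gamma> M A \<Theta>"
  using assms by (auto simp: typable_def)

lemma typableI: "typing \<Gamma> M A \<Theta> \<Longrightarrow> M \<in> typable"
  by (auto simp: typable_def)

lemma typable_apps_head: "apps M Ps \<in> typable \<Longrightarrow> M \<in> typable"
  by (auto simp: typable_iff dbtyping_apps_iff)

lemma typable_App: "App M N \<in> typable \<Longrightarrow> M \<in> typable \<and> N \<in> typable"
  by (auto elim!: typableE simp: typing_App_iff intro: typableI)

lemma typable_Lam: "Lam x M \<in> typable \<Longrightarrow> M \<in> typable"
  by (auto elim!: typableE simp: typing_Lam_iff intro: typableI)

lemma typable_Mu: "Mu \<alpha> M \<in> typable \<Longrightarrow> M \<in> typable"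
  by (auto elim!: typableE simp: typing_Mu_iff intro: typableI)

lemma typable_Nam: "Nam \<alpha> M \<in> typable \<Longrightarrow> M \<in> typable"
  by (auto elim!: typableE simp: typing_Nam_iff intro: typableI)

text \<open>The substitution lemma gives the contractum the type of the redex, so the remaining
  arguments still fit.\<close>

lemma typable_beta:
  assumes "apps (App (Lam x M) N) Ps \<in> typable"
  shows "apps (subst M x N) Ps \<in> typable"
proof -
  obtain \<Gamma> \<Theta> A B D where M: "dbtyping ((fmlookup \<Gamma>)(x := Some A)) M B (fmlookup \<Theta>)"
    and N: "dbtyping (fmlookup \<Gamma>) N A (fmlookup \<Theta>)"
    and Ps: "spine_typing (fmlookup \<Gamma>) (fmlookup \<Theta>) Ps B D"
    using assms by (auto simp: typable_iff dbtyping_apps_iff dbtyping_Lam_iff elim!: dbtyping_AppE)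
  have "dbtyping (fmlookup \<Gamma>) (subst M x N) B (fmlookup \<Theta>)"
    unfolding subst_def using M
    by (rule dbtyping_simsubst) (auto intro: dbtyping.Var N split: if_splits)
  then show ?thesis using Ps by (auto simp: typable_iff dbtyping_apps_iff)
qed

text \<open>After absorbing \<open>Ps\<close>, the bound \<alpha> changes from the type
  \<open>A\<close> of the head to the type \<open>D\<close> of the whole application.\<close>

lemma typable_mu:
  assumes "apps (Mu \<alpha> M) Ps \<in> typable" and fresh: "\<And>P. P \<in> set Ps \<Longrightarrow> \<alpha> \<notin> fmv P"
  shows "Mu \<alpha> (rsubsts M \<alpha> Ps) \<in> typable"
proof -
  obtain \<Gamma> \<Theta> A D where M: "dbtyping (fmlookup \<Gamma>) M Bot ((fmlookup \<Theta>)(\<alpha> := Some A))"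
    and Ps: "spine_typing (fmlookup \<Gamma>) (fmlookup \<Theta>) Ps A D"
    using assms by (auto simp: typable_iff dbtyping_apps_iff dbtyping_Mu_iff)
  \<comment> \<open>Identity renamings serve only to change the context at \<alpha>, which is free
    in no member of \<open>Ps\<close>.\<close>
  have "spine_typing (fmlookup \<Gamma>) ((fmlookup \<Theta>)(\<alpha> := Some D)) (map (ren id id) Ps) A D"
    using Ps by (rule spine_typing_ren) (use fresh in auto)
  then have Ps': "spine_typing (fmlookup \<Gamma>) ((fmlookup \<Theta>)(\<alpha> := Some D)) Ps A D"
    by (simp add: ren_id map_idI)
  have rsubsts_Ps: "rsubsts M \<alpha> Ps = simsubst Var ((\<lambda>_. [])(\<alpha> := Ps)) M"
    using fresh by (rule rsubsts_eq_simsubst)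
  have "dbtyping (fmlookup \<Gamma>) (rsubsts M \<alpha> Ps) Bot ((fmlookup \<Theta>)(\<alpha> := Some D))"
    unfolding rsubsts_Ps using M
    by (rule dbtyping_simsubst) (auto intro: dbtyping.Var Ps' split: if_splits)
  then show ?thesis by (auto simp: typable_iff dbtyping_Mu_iff)
qed

text \<open>\<open>F\<close> holds the names that a later substitution could capture; equality of
  sizes makes the opened body accessible to induction on size.\<close>

lemma typing_LamB_fresh:
  assumes "typing \<Gamma> (LamB M) C \<Theta>" and "finite F"
  obtains x A B M' where "x \<notin> F" "x |\<notin>| fmdom \<Gamma>" "LamB M = Lam x M'" "size M' = size M"
    "C = Arr A B" "typing (fmupd x A \<Gamma>) M' B \<Theta>"
proof -
  obtain x where x: "x \<notin> F \<union> fset (fmdom \<Gamma>) \<union> fv (LamB M)"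
    using ex_new_if_finite[OF infinite_UNIV_nat] finite_fv assms(2) by (metis finite_Un finite_fset)
  then have eq: "LamB M = Lam x (ren (case_nat x id) id M)" by (simp add: LamB_eq_Lam_ren)
  with assms(1) obtain A B where "C = Arr A B"
    "typing (fmupd x A \<Gamma>) (ren (case_nat x id) id M) B \<Theta>"
    by (auto simp: typing_Lam_iff)
  then show thesis using x by (intro that[OF _ _ eq]) (auto simp: size_ren)
qed

lemma typing_MuB_fresh:
  assumes "typing \<Gamma> (MuB M) A \<Theta>" and "finite F"
  obtains \<alpha> M' where "\<alpha> \<notin> F" "\<alpha> |\<notin>| fmdom \<Theta>" "MuB M = Mu \<alpha> M'" "size M' = size M"
    "typing \<Gamma> M' Bot (fmupd \<alpha> A \<Theta>)"
proof -
  obtain \<alpha> where \<alpha>: "\<alpha> \<notin> F \<union> fset (fmdom \<Theta>) \<union> fmv (MuB M)"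
    using ex_new_if_finite[OF infinite_UNIV_nat] finite_fmv assms(2) by (metis finite_Un finite_fset)
  then have eq: "MuB M = Mu \<alpha> (ren id (case_nat \<alpha> id) M)" by (simp add: MuB_eq_Mu_ren)
  with assms(1) have "typing \<Gamma> (ren id (case_nat \<alpha> id) M) Bot (fmupd \<alpha> A \<Theta>)"
    by (auto simp: typing_Mu_iff)
  then show thesis using \<alpha> by (intro that[OF _ _ eq]) (auto simp: size_ren)
qed

subsection \<open>Saturation of the sets of the model\<close>

context
  fixes \<B> :: "trm set"
  assumes sat: "saturated \<B>"
begin

lemma saturated_Lam: "M \<in> \<B> \<Longrightarrow> Lam x M \<in> \<B>"
  using sat unfolding saturated_def by blast

lemma saturated_Mu: "M \<in> \<B> \<Longrightarrow> Mu \<alpha> M \<in> typable \<Longrightarrow> Mu \<alpha> M \<in> \<B>"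
  using sat unfolding saturated_def by blast

lemma saturated_Nam: "M \<in> \<B> \<Longrightarrow> Nam \<alpha> M \<in> typable \<Longrightarrow> Nam \<alpha> M \<in> \<B>"
  using sat unfolding saturated_def by blast

lemma saturated_mu_apps:
  assumes "apps (Mu \<alpha> M) Ns \<in> typable" "Ns \<in> lists \<B>" "\<forall>N\<in>set Ns. \<alpha> \<notin> fmv N"
    and "Mu \<alpha> (rsubsts M \<alpha> Ns) \<in> \<B>"
  shows "apps (Mu \<alpha> M) Ns \<in> \<B>"
proof -
  have "M \<in> typable" using assms(1) typable_apps_head typable_Mu by blast
  then show ?thesis using sat assms unfolding saturated_def by blast
qed

lemma rel_saturated_base: "rel_saturated \<B> \<B>"
proof -
  \<comment> \<open>With no sequences to test, only membership in \<B> remains. Clauses (D1) and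
    (D2) become (C5) and (C4).\<close>
  have "\<B> = seq_arrow \<B> {}" by (auto simp: seq_arrow_def)
  then have "\<exists>\<X> \<subseteq> lists \<B>. \<B> = seq_arrow \<B> \<X>" by blast
  then show ?thesis using sat unfolding rel_saturated_def saturated_def by simp
qed

text \<open>A prefix of \<open>N # Ns\<close> is empty or consists of \<open>N\<close> and a prefix
  of \<open>Ns\<close>. The added \<open>[]\<close> ensures that \<open>App M N\<close> is tested
  even when \<X> is empty.\<close>

lemma arrow_eq_seq_arrow:
  "arrow \<B> U (seq_arrow \<B> \<X>) = seq_arrow \<B> {N # Ns |N Ns. N \<in> U \<and> Ns \<in> insert [] \<X>}"
  (is "?L = ?R")
proof (rule set_eqI)
  fix M
  show "M \<in> ?L \<longleftrightarrow> M \<in> ?R"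
  proof
    assume M: "M \<in> ?L"
    have "apps M Ps \<in> \<B>"
      if "N \<in> U" "Ns \<in> insert [] \<X>" "prefix Ps (N # Ns)" "apps M Ps \<in> typable" for N Ns Ps
    proof (cases Ps)
      case Nil
      then show ?thesis using M by (simp add: arrow_def)
    next
      case (Cons P Qs)
      then have "P = N" "prefix Qs Ns" using that(3) by auto
      moreover from this have "apps (App M N) Qs \<in> typable" using that(4) Cons by simp
      moreover from this have "App M N \<in> seq_arrow \<B> \<X>"
        using M that(1) typable_apps_head unfolding arrow_def by blast
      ultimately show ?thesis using Cons that(2) by (auto simp: seq_arrow_def)
    qed
    then show "M \<in> ?R" using M by (auto simp: seq_arrow_def arrow_def)
  next
    assume M: "M \<in> ?R"
    have app: "apps (App M N) Ps \<in> \<B>"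
      if "N \<in> U" "Ns \<in> insert [] \<X>" "prefix Ps Ns" "apps (App M N) Ps \<in> typable" for N Ns Ps
    proof -
      have "N # Ns \<in> {N # Ns |N Ns. N \<in> U \<and> Ns \<in> insert [] \<X>}" using that by blast
      moreover have "prefix (N # Ps) (N # Ns)" using that by simp
      ultimately have "apps M (N # Ps) \<in> typable \<longrightarrow> apps M (N # Ps) \<in> \<B>"
        using M unfolding seq_arrow_def by blast
      then show ?thesis using that(4) by simp
    qed
    have "App M N \<in> seq_arrow \<B> \<X>" if "N \<in> U" "App M N \<in> typable" for N
      \<comment> \<open>The first instance gives \<open>App M N\<close> in \<B>, the second the
        condition for the sequences in \<X>.\<close>
      using app[OF that(1), of "[]" "[]"] app[OF that(1)] that(2) by (auto simp: seq_arrow_def)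
    then show "M \<in> ?L" using M by (auto simp: seq_arrow_def arrow_def)
  qed
qed

text \<open>Clauses (D1) and (D2) allow any number of trailing arguments, so testing against
  \<open>Q\<close> in \<open>U\<close> reduces to the same clause of \<open>V\<close> with
  \<open>Q\<close> appended.\<close>

lemma rel_saturated_arrow:
  assumes U: "rel_saturated \<B> U" and V: "rel_saturated \<B> V"
  shows "rel_saturated \<B> (arrow \<B> U V)"
proof -
  have U_sub: "U \<subseteq> \<B>" using U by (simp add: rel_saturated_def)
  have expansion: "apps (App (Lam x M) N) Ps \<in> arrow \<B> U V"
    if "M \<in> typable" "N \<in> typable" "Ps \<in> lists typable" "N \<in> \<B>"
      "apps (App (Lam x M) N) Ps \<in> typable" and red: "apps (subst M x N) Ps \<in> arrow \<B> U V"
    for x M N Ps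
  proof -
    have "apps (App (Lam x M) N) Ps \<in> \<B>"
    proof -
      have "apps (subst M x N) Ps \<in> \<B>" using red by (simp add: arrow_def)
      then show ?thesis using rel_saturated_base that unfolding rel_saturated_def by blast
    qed
    moreover have "App (apps (App (Lam x M) N) Ps) Q \<in> V"
      if Q: "Q \<in> U" "App (apps (App (Lam x M) N) Ps) Q \<in> typable" for Q
    proof -
      have wt: "apps (App (Lam x M) N) (Ps @ [Q]) \<in> typable" using Q by simp
      \<comment> \<open>Membership in the arrow set speaks only of typable applications, so
        typability must first pass to the contractum.\<close>
      from typable_beta[OF this] have "apps (subst M x N) (Ps @ [Q]) \<in> V"
        using red Q(1) by (simp add: arrow_def)
      moreover have "Ps @ [Q] \<in> lists typable"
        using \<open>Ps \<in> lists typable\<close> typable_App[OF Q(2)] by auto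
      ultimately have "apps (App (Lam x M) N) (Ps @ [Q]) \<in> V"
        using V wt \<open>M \<in> typable\<close> \<open>N \<in> typable\<close> \<open>N \<in> \<B>\<close> unfolding rel_saturated_def by blast
      then show ?thesis by simp
    qed
    ultimately show ?thesis by (simp add: arrow_def)
  qed
  have vars: "apps (Var x) Ns \<in> arrow \<B> U V"
    if "Ns \<in> lists \<B>" "apps (Var x) Ns \<in> typable" for x Ns
  proof -
    have "apps (Var x) Ns \<in> \<B>"
      using rel_saturated_base that unfolding rel_saturated_def by blast
    moreover have "App (apps (Var x) Ns) Q \<in> V"
      if Q: "Q \<in> U" "App (apps (Var x) Ns) Q \<in> typable" for Q
    proof -
      have "Ns @ [Q] \<in> lists \<B>" using \<open>Ns \<in> lists \<B>\<close> Q(1) U_sub by auto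
      moreover have "apps (Var x) (Ns @ [Q]) \<in> typable" using Q(2) by simp
      ultimately have "apps (Var x) (Ns @ [Q]) \<in> V"
        using V unfolding rel_saturated_def by blast
      then show ?thesis by simp
    qed
    ultimately show ?thesis by (simp add: arrow_def)
  qed
  obtain \<X> where \<X>: "\<X> \<subseteq> lists \<B>" "V = seq_arrow \<B> \<X>"
    using V unfolding rel_saturated_def by blast
  have "N # Ns \<in> lists \<B>" if "N \<in> U" "Ns \<in> insert [] \<X>" for N Ns
    using that \<X>(1) U_sub by (auto simp: subset_iff in_lists_conv_set)
  then have "{N # Ns |N Ns. N \<in> U \<and> Ns \<in> insert [] \<X>} \<subseteq> lists \<B>" by blast
  then have "\<exists>\<X> \<subseteq> lists \<B>. arrow \<B> U V = seq_arrow \<B> \<X>"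
    unfolding \<X>(2) arrow_eq_seq_arrow by blast
  moreover have "arrow \<B> U V \<subseteq> \<B>" by (auto simp: arrow_def)
  ultimately show ?thesis using expansion vars unfolding rel_saturated_def by blast
qed

lemma rel_saturated_model:
  assumes "\<And>i. i \<in> J \<Longrightarrow> rel_saturated \<B> (\<S> i)" and "U \<in> model \<B> J \<S>"
  shows "rel_saturated \<B> U"
  using assms(2)
  by (induction rule: model.induct) (auto intro: rel_saturated_base rel_saturated_arrow assms(1))

lemma interp_in_model:
  assumes "\<And>X. \<I> X \<in> model \<B> J \<S>"
  shows "interp \<B> \<I> A \<in> model \<B> J \<S>"
  by (induction A) (auto intro: model.intros assms)

subsection \<open>Adequacy\<close>

text \<open>Clause (D1) of \<open>V\<close> with no further arguments lifts the contractum to the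
  redex; \<open>N\<close> lies in \<B> because \<open>U\<close> does.\<close>

lemma Lam_in_arrow:
  assumes U: "rel_saturated \<B> U" and V: "rel_saturated \<B> V" and "Lam x M \<in> \<B>"
    and red: "\<And>N. N \<in> U \<Longrightarrow> subst M x N \<in> typable \<Longrightarrow> subst M x N \<in> V"
  shows "Lam x M \<in> arrow \<B> U V"
proof -
  have "App (Lam x M) N \<in> V" if N: "N \<in> U" "App (Lam x M) N \<in> typable" for N
  proof -
    have "N \<in> \<B>" using N(1) U unfolding rel_saturated_def by blast
    have wt: "apps (App (Lam x M) N) [] \<in> typable" using N(2) by simp
    from typable_beta[OF this] red[OF N(1)] have "apps (subst M x N) [] \<in> V" by simp
    moreover have "M \<in> typable" "N \<in> typable" using N(2) typable_App typable_Lam by blast+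
    ultimately have "apps (App (Lam x M) N) [] \<in> V"
      using V wt \<open>N \<in> \<B>\<close> unfolding rel_saturated_def by blast
    then show ?thesis by simp
  qed
  then show ?thesis using assms(3) by (simp add: arrow_def)
qed

text \<open>Contexts and substitution vary in the induction because both grow at a binder. The
  sequence extending \<open>r \<alpha>\<close> is existential, so that a newly bound \<alpha> can
  receive any initial segment.\<close>

lemma adequacy:
  assumes sat_interp: "\<And>A. rel_saturated \<B> (interp \<B> \<I> A)"
    and "\<And>x C. fmlookup \<Gamma> x = Some C \<Longrightarrow> s x \<in> interp \<B> \<I> C"
    and "\<And>x. x |\<notin>| fmdom \<Gamma> \<Longrightarrow> s x = Var x"
    and "\<And>\<alpha> C. fmlookup \<Theta> \<alpha> = Some C \<Longrightarrow>
           \<exists>Ns. prefix (r \<alpha>) Ns \<and> Ns \<in> seqs \<B> (interp \<B> \<I> C)"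
    and "\<And>\<alpha>. \<alpha> |\<notin>| fmdom \<Theta> \<Longrightarrow> r \<alpha> = []"
    and "typing \<Gamma> M A \<Theta>"
    and "simsubst s r M \<in> typable"
  shows "simsubst s r M \<in> interp \<B> \<I> A"
  using assms(2-)
proof (induction "size M" arbitrary: M \<Gamma> \<Theta> s r A rule: less_induct)
  case less
  note s_in = less.prems(1) and s_out = less.prems(2) and r_in = less.prems(3)
    and r_out = less.prems(4) and wt = less.prems(5) and typable = less.prems(6)
  define D where "D = fset (fmdom \<Gamma>)"
  define E where "E = fset (fmdom \<Theta>)"
  \<comment> \<open>These are the names on which the substitution may act and those free in what it
    inserts. Finiteness of the contexts makes the set finite.\<close>
  define F where "F = D \<union> (\<Union>y\<in>D. fv (s y)) \<union> (\<Union>\<beta>\<in>E. \<Union>P\<in>set (r \<beta>). fv P)"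
  define F' where "F' = E \<union> (\<Union>y\<in>D. fmv (s y)) \<union> (\<Union>\<beta>\<in>E. \<Union>P\<in>set (r \<beta>). fmv P)"
  have finite: "finite F" "finite F'"
    by (auto simp: F_def F'_def D_def E_def finite_fv finite_fmv)
  have fresh_F: "s x = Var x" "\<And>y. y \<noteq> x \<Longrightarrow> x \<notin> fv (s y)"
    "\<And>\<beta> P. P \<in> set (r \<beta>) \<Longrightarrow> x \<notin> fv P" if "x \<notin> F" for x
  proof -
    show "s x = Var x" using that s_out by (auto simp: F_def D_def)
    show "x \<notin> fv (s y)" if "y \<noteq> x" for y
      using \<open>x \<notin> F\<close> that s_out[of y] by (cases "y \<in> D") (auto simp: F_def D_def)
    show "x \<notin> fv P" if "P \<in> set (r \<beta>)" for \<beta> P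
      using \<open>x \<notin> F\<close> that r_out[of \<beta>] by (cases "\<beta> \<in> E") (auto simp: F_def E_def)
  qed
  have fresh_F': "r \<alpha> = []" "\<And>y. \<alpha> \<notin> fmv (s y)"
    "\<And>\<beta> P. P \<in> set (r \<beta>) \<Longrightarrow> \<alpha> \<notin> fmv P" if "\<alpha> \<notin> F'" for \<alpha>
  proof -
    show "r \<alpha> = []" using that r_out by (auto simp: F'_def E_def)
    show "\<alpha> \<notin> fmv (s y)" for y
      using \<open>\<alpha> \<notin> F'\<close> s_out[of y] by (cases "y \<in> D") (auto simp: F'_def D_def)
    show "\<alpha> \<notin> fmv P" if "P \<in> set (r \<beta>)" for \<beta> P
      using \<open>\<alpha> \<notin> F'\<close> that r_out[of \<beta>] by (cases "\<beta> \<in> E") (auto simp: F'_def E_def)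
  qed
  have IH: "simsubst s r P \<in> interp \<B> \<I> C"
    if "size P < size M" "typing \<Gamma> P C \<Theta>" "simsubst s r P \<in> typable" for P C
  proof (rule less.hyps[OF that(1) _ _ _ _ that(2,3)])
    show "s x \<in> interp \<B> \<I> C" if "fmlookup \<Gamma> x = Some C" for x C using s_in that .
    show "s x = Var x" if "x |\<notin>| fmdom \<Gamma>" for x using s_out that .
    show "\<exists>Ns. prefix (r \<alpha>) Ns \<and> Ns \<in> seqs \<B> (interp \<B> \<I> C)"
      if "fmlookup \<Theta> \<alpha> = Some C" for \<alpha> C using r_in that .
    show "r \<alpha> = []" if "\<alpha> |\<notin>| fmdom \<Theta>" for \<alpha> using r_out that .
  qed
  show ?case
  proof (cases M)
    case (Var x)
    then show ?thesis using wt s_in by (simp add: typing_Var_iff)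
  next
    case (App P Q)
    then obtain C where P: "typing \<Gamma> P (Arr C A) \<Theta>" and Q: "typing \<Gamma> Q C \<Theta>"
      using wt by (auto simp: typing_App_iff)
    have "simsubst s r P \<in> typable" "simsubst s r Q \<in> typable"
      using typable typable_App unfolding App simsubst.simps by blast+
    then have "simsubst s r P \<in> interp \<B> \<I> (Arr C A)"
      and "simsubst s r Q \<in> interp \<B> \<I> C"
      using IH[OF _ P] IH[OF _ Q] App by simp_all
    then show ?thesis using App typable by (simp add: arrow_def)
  next
    case (Nam \<alpha> P)
    then obtain C where A: "A = Bot" and \<alpha>: "fmlookup \<Theta> \<alpha> = Some C" and P: "typing \<Gamma> P C \<Theta>"
      using wt by (auto simp: typing_Nam_iff)
    let ?P = "simsubst s r P"
    have typ_apps: "apps ?P (r \<alpha>) \<in> typable"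
      using typable typable_Nam unfolding Nam simsubst.simps by blast
    then have P_in: "?P \<in> interp \<B> \<I> C"
      using IH[OF _ P typable_apps_head] Nam by simp
    obtain Ns where Ns: "prefix (r \<alpha>) Ns" "Ns \<in> seqs \<B> (interp \<B> \<I> C)"
      using r_in[OF \<alpha>] by blast
    have "apps ?P (r \<alpha>) \<in> \<B>"
    \<comment> \<open>The empty sequence belongs to \<open>seqs\<close> by definition, possibly
      without lying in any \<X>. Then \<open>r \<alpha>\<close> is empty, and the inclusion of the
      interpretation in \<B> suffices.\<close>
    proof (cases "Ns = []")
      case True
      then show ?thesis using Ns(1) P_in sat_interp[of C] by (auto simp: rel_saturated_def)
    next
      case False
      then obtain \<X> where "interp \<B> \<I> C = seq_arrow \<B> \<X>" "Ns \<in> \<X>"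
        using Ns(2) by (auto simp: seqs_def)
      then show ?thesis using P_in Ns(1) typ_apps by (auto simp: seq_arrow_def)
    qed
    then show ?thesis using saturated_Nam[of _ \<alpha>] typable Nam A by simp
  next
    case (LamB M0)
    obtain x C B M' where x: "x \<notin> F" "x |\<notin>| fmdom \<Gamma>" and M': "M = Lam x M'" "size M' = size M0"
      and A: "A = Arr C B" and wt': "typing (fmupd x C \<Gamma>) M' B \<Theta>"
      using typing_LamB_fresh[OF _ finite(1)] wt LamB by metis
    have M_eq: "simsubst s r M = Lam x (simsubst s r M')"
      unfolding M'(1) by (rule simsubst_Lam) (use fresh_F[OF x(1)] in auto)
    have body: "simsubst (s(x := N)) r M' \<in> interp \<B> \<I> B"
      if "N \<in> interp \<B> \<I> C" "simsubst (s(x := N)) r M' \<in> typable" for N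
    proof (rule less.hyps[OF _ _ _ _ _ wt' that(2)])
      show "size M' < size M" using LamB M'(2) by simp
      show "(s(x := N)) y \<in> interp \<B> \<I> D" if "fmlookup (fmupd x C \<Gamma>) y = Some D" for y D
        using that s_in \<open>N \<in> interp \<B> \<I> C\<close> by (auto split: if_splits)
      show "(s(x := N)) y = Var y" if "y |\<notin>| fmdom (fmupd x C \<Gamma>)" for y
        using that s_out by auto
      show "\<exists>Ns. prefix (r \<alpha>) Ns \<and> Ns \<in> seqs \<B> (interp \<B> \<I> C)"
        if "fmlookup \<Theta> \<alpha> = Some C" for \<alpha> C using r_in that .
      show "r \<alpha> = []" if "\<alpha> |\<notin>| fmdom \<Theta>" for \<alpha> using r_out that .
    qed
    \<comment> \<open>Taking \<open>Var x\<close> itself as the argument leaves the substitution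
      unchanged. This puts the body in \<B>, as required to apply (C1) to the abstraction.\<close>
    have "Var x \<in> interp \<B> \<I> C"
    proof -
      have "Var x \<in> typable"
        by (rule typableI[of "fmupd x C \<Gamma>" _ C \<Theta>]) (simp add: typing_Var_iff)
      then have "[] \<in> lists \<B>" "apps (Var x) [] \<in> typable" by auto
      then have "apps (Var x) [] \<in> interp \<B> \<I> C"
        using sat_interp[of C] unfolding rel_saturated_def by blast
      then show ?thesis by simp
    qed
    moreover have "s(x := Var x) = s" using fresh_F(1)[OF x(1)] by auto
    ultimately have "simsubst s r M' \<in> interp \<B> \<I> B"
      using body[of "Var x"] typable_Lam[of x "simsubst s r M'"] typable M_eq by simp
    then have "simsubst s r M' \<in> \<B>" using sat_interp[of B] by (auto simp: rel_saturated_def)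
    moreover have subst_eq: "subst (simsubst s r M') x N = simsubst (s(x := N)) r M'" for N
      by (rule subst_simsubst) (use fresh_F[OF x(1)] in auto)
    ultimately have "Lam x (simsubst s r M') \<in> arrow \<B> (interp \<B> \<I> C) (interp \<B> \<I> B)"
      using body subst_eq
      by (intro Lam_in_arrow sat_interp saturated_Lam) auto
    then show ?thesis using A M_eq by simp
  next
    case (MuB M0)
    \<comment> \<open>The bound name is chosen only after \<open>Qs\<close> is fixed, since (C6)
      requires it to be fresh for these arguments.\<close>
    have in_B: "apps (simsubst s r M) Qs \<in> \<B>"
      if Qs: "prefix Qs Ns" "Ns \<in> seqs \<B> (interp \<B> \<I> A)" "Qs \<in> lists \<B>"
        "apps (simsubst s r M) Qs \<in> typable" for Qs Ns
    proof -
      have "finite (F' \<union> (\<Union>P\<in>set Qs. fmv P))" using finite(2) by (auto simp: finite_fmv)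
      from typing_MuB_fresh[OF wt[unfolded MuB] this] obtain \<alpha> M'
        where "\<alpha> \<notin> F' \<union> (\<Union>P\<in>set Qs. fmv P)" "\<alpha> |\<notin>| fmdom \<Theta>"
          and "MuB M0 = Mu \<alpha> M'" and M'_size: "size M' = size M0"
          and wt': "typing \<Gamma> M' Bot (fmupd \<alpha> A \<Theta>)" .
      then have \<alpha>: "\<alpha> \<notin> F'" "\<forall>P\<in>set Qs. \<alpha> \<notin> fmv P" "\<alpha> |\<notin>| fmdom \<Theta>"
        and M': "M = Mu \<alpha> M'"
        using MuB by auto
      have M_eq: "simsubst s r M = Mu \<alpha> (simsubst s r M')"
        unfolding M' by (rule simsubst_Mu) (use fresh_F'[OF \<alpha>(1)] in auto)
      have body_eq: "rsubsts (simsubst s r M') \<alpha> Qs = simsubst s (r(\<alpha> := Qs)) M'"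
        by (rule rsubsts_simsubst) (use fresh_F'[OF \<alpha>(1)] \<alpha>(2) in auto)
      have typ_Mu: "Mu \<alpha> (simsubst s (r(\<alpha> := Qs)) M') \<in> typable"
        using typable_mu[of \<alpha> "simsubst s r M'" Qs] Qs(4) \<alpha>(2) by (simp add: M_eq body_eq)
      have "simsubst s (r(\<alpha> := Qs)) M' \<in> interp \<B> \<I> Bot"
      \<comment> \<open>The extended substitution is admissible because \<alpha> has type
        \<open>A\<close> and \<open>Qs\<close> is an initial segment of a sequence in
        \<open>seqs\<close> for \<open>A\<close>.\<close>
      proof (rule less.hyps[OF _ _ _ _ _ wt' typable_Mu[OF typ_Mu]])
        show "size M' < size M" using MuB M'_size by simp
        show "s x \<in> interp \<B> \<I> C" if "fmlookup \<Gamma> x = Some C" for x C using s_in that .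
        show "s x = Var x" if "x |\<notin>| fmdom \<Gamma>" for x using s_out that .
        show "\<exists>Ns. prefix ((r(\<alpha> := Qs)) \<beta>) Ns \<and> Ns \<in> seqs \<B> (interp \<B> \<I> C)"
          if "fmlookup (fmupd \<alpha> A \<Theta>) \<beta> = Some C" for \<beta> C
          using that r_in Qs(1,2) by (auto split: if_splits)
        show "(r(\<alpha> := Qs)) \<beta> = []" if "\<beta> |\<notin>| fmdom (fmupd \<alpha> A \<Theta>)" for \<beta>
          using that r_out by auto
      qed
      then have "Mu \<alpha> (rsubsts (simsubst s r M') \<alpha> Qs) \<in> \<B>"
        using saturated_Mu[OF _ typ_Mu] by (simp add: body_eq)
      then show ?thesis
        using saturated_mu_apps[OF _ Qs(3) \<alpha>(2)] Qs(4) by (simp add: M_eq)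
    qed
    obtain \<X> where \<X>: "\<X> \<subseteq> lists \<B>" "interp \<B> \<I> A = seq_arrow \<B> \<X>"
      using sat_interp[of A] unfolding rel_saturated_def by blast
    have "simsubst s r M \<in> \<B>"
      \<comment> \<open>The default member \<open>[]\<close> of \<open>seqs\<close> covers the case
        without arguments, even if \<X> is empty.\<close>
      using in_B[of "[]" "[]"] typable by (auto simp: seqs_def)
    moreover have "apps (simsubst s r M) Qs \<in> \<B>"
      if "Ns \<in> \<X>" "prefix Qs Ns" "apps (simsubst s r M) Qs \<in> typable" for Qs Ns
    proof (rule in_B[OF that(2) _ _ that(3)])
      show "Ns \<in> seqs \<B> (interp \<B> \<I> A)" using \<X> that(1) by (auto simp: seqs_def)
      have "Ns \<in> lists \<B>" using \<X>(1) that(1) by blast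
      then show "Qs \<in> lists \<B>" using set_mono_prefix[OF that(2)] by auto
    qed
    ultimately show ?thesis unfolding \<X>(2) by (auto simp: seq_arrow_def)
  qed
qed

end

theorem theorem3p15:
  fixes \<B> :: "trm set" and J :: "'i set" and \<S> :: "'i \<Rightarrow> trm set"
    and \<I> :: "nat \<Rightarrow> trm set" and \<Gamma> \<Theta> :: ctx
    and Ms :: "nat \<Rightarrow> trm" and Ps Ns :: "nat \<Rightarrow> trm list"
    and s :: "nat \<Rightarrow> trm" and r :: "nat \<Rightarrow> trm list"
    and M :: trm and A :: ty
  assumes "saturated \<B>"
    and "\<And>i. i \<in> J \<Longrightarrow> rel_saturated \<B> (\<S> i)"
    and "\<And>X. \<I> X \<in> model \<B> J \<S>"
    and "\<And>x C. fmlookup \<Gamma> x = Some C \<Longrightarrow> Ms x \<in> interp \<B> \<I> C"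
    and "\<And>\<alpha> C. fmlookup \<Theta> \<alpha> = Some C \<Longrightarrow>
           prefix (Ps \<alpha>) (Ns \<alpha>) \<and> Ns \<alpha> \<in> seqs \<B> (interp \<B> \<I> C)"
    and "s = (\<lambda>x. if x |\<in>| fmdom \<Gamma> then Ms x else Var x)"
    and "r = (\<lambda>\<alpha>. if \<alpha> |\<in>| fmdom \<Theta> then Ps \<alpha> else [])"
    and "typing \<Gamma> M A \<Theta>"
    and "simsubst s r M \<in> typable"
  shows "simsubst s r M \<in> interp \<B> \<I> A"
proof (rule adequacy[OF assms(1) _ _ _ _ _ assms(8,9)])
  \<comment> \<open>Types are interpreted by members of the model, and \<B>-saturation passes from
    \<B> and the given family to all of them.\<close>
  show "rel_saturated \<B> (interp \<B> \<I> A)" for A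
    using rel_saturated_model[OF assms(1,2) interp_in_model[OF assms(1,3)]] .
  show "s x \<in> interp \<B> \<I> C" if "fmlookup \<Gamma> x = Some C" for x C
    using assms(4)[OF that] that by (simp add: assms(6) fmdomI)
  show "\<exists>Ns. prefix (r \<alpha>) Ns \<and> Ns \<in> seqs \<B> (interp \<B> \<I> C)" if "fmlookup \<Theta> \<alpha> = Some C" for \<alpha> C
    using assms(5)[OF that] that by (auto simp: assms(7) fmdomI)
qed (simp_all add: assms(6,7))

end
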